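(* Let $\lambda$ be a nonzero real number, $m$ a positive integer, $n\ge0$ an integer, and $p(x)\in\mathbb{C}[x]$ a polynomial of degree at most $n$. Then $$p(x)=\sum_{k=0}^{n}C_k\,d_{m,\lambda}(k,x),\qquad\text{where } C_k=\frac{1}{k!}\Big\langle (mt+1)^{-\frac{1}{m}}\Big(\frac{1}{m}\log_{\frac{\lambda}{m}}(1+mt)\Big)^{k}\,\Big|\,p(x)\Big\rangle_\lambda .$$
   Context: For $\mu\neq 0$: $(x)_{0,\mu}=1$ and $(x)_{n,\mu}=x(x-\mu)\cdots(x-(n-1)\mu)$ for $n\ge1$; $e_\mu^{x}(t)=\sum_{k\ge0}(x)_{k,\mu}\frac{t^k}{k!}=(1+\mu t)^{x/\mu}$, $e_\mu(t)=e^1_\mu(t)$, and $\log_\mu(1+t)=\frac{1}{\mu}\big((1+t)^\mu-1\big)$ is the compositional inverse of $e_\mu(t)$; in particular $\log_{\lambda/m}(1+mt)=\frac{m}{\lambda}\big((1+mt)^{\lambda/m}-1\big)$. For a formal power series $f(t)=\sum_{k\ge0}a_k\frac{t^k}{k!}$, $\langle f(t)\,|\,\cdot\,\rangle_\lambda$ is the linear functional on $\mathbb{C}[x]$ determined by $\langle f(t)\,|\,(x)_{k,\lambda}\rangle_\lambda=a_k$ for all $k\ge0$. The degenerate Whitney numbers of the second kind are defined by $e_\lambda(t)\frac{1}{k!}\Big(\frac{e_\lambda^{m}(t)-1}{m}\Big)^k=\sum_{n\ge k}W_{m,\lambda}(n,k)\frac{t^n}{n!}$, and the fully degenerate Dowling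 polynomials are $d_{m,\lambda}(n,x)=\sum_{k=0}^{n}W_{m,\lambda}(n,k)(x)_{k,\lambda}$. *)

theory Defs
  imports Complex_Main "HOL-Computational_Algebra.Computational_Algebra"
begin

text \<open>The ring is left generic because \<open>(x)\<^sub>n\<^sub>,\<^sub>\<mu>\<close> is used both for a number
  \<open>x\<close> and for the indeterminate.\<close>

definition dfact :: "'a::comm_ring_1 \<Rightarrow> 'a \<Rightarrow> nat \<Rightarrow> 'a" where
  "dfact \<mu> x n = (\<Prod>i<n. x - of_nat i * \<mu>)"

abbreviation dfact_poly :: "complex \<Rightarrow> nat \<Rightarrow> complex poly" where
  "dfact_poly \<mu> n \<equiv> dfact [:\<mu>:] [:0, 1:] n"

definition dexp :: "complex \<Rightarrow> complex \<Rightarrow> complex fps" where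
  "dexp \<mu> x = Abs_fps (\<lambda>k. dfact \<mu> x k / fact k)"

text \<open>\<open>log\<^sub>\<mu>(1 + t)\<close> as a power series in \<open>t\<close>; \<open>fps_binomial a\<close> is \<open>(1 + t)\<^sup>a\<close>.\<close>

definition dlog1p :: "complex \<Rightarrow> complex fps" where
  "dlog1p \<mu> = fps_const (1 / \<mu>) * (fps_binomial \<mu> - 1)"

text \<open>\<open>f(ct)\<close> for a power series \<open>f(t)\<close>.\<close>

abbreviation fps_dilate :: "complex \<Rightarrow> complex fps \<Rightarrow> complex fps" where
  "fps_dilate c f \<equiv> fps_compose f (fps_const c * fps_X)"

definition dumbral_functional ::
    "complex \<Rightarrow> complex fps \<Rightarrow> (complex poly \<Rightarrow> complex) \<Rightarrow> bool" where
  "dumbral_functional \<mu> f L \<longleftrightarrow>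
     Vector_Spaces.linear smult (*) L \<and> (\<forall>k. L (dfact_poly \<mu> k) = fact k * fps_nth f k)"

text \<open>\<open>\<langle>f(t) | p(x)\<rangle>\<^sub>\<mu>\<close>; the functional exists uniquely by
  \<open>dumbral_functional_ex1\<close> below.\<close>

definition dumbral :: "complex \<Rightarrow> complex fps \<Rightarrow> complex poly \<Rightarrow> complex" where
  "dumbral \<mu> f = (THE L. dumbral_functional \<mu> f L)"

text \<open>The coefficient is extracted for all \<open>n\<close>; it vanishes for \<open>n < k\<close>
  (\<open>dWhitney_eq_0\<close> below), so the generating function starts at \<open>n = k\<close>.\<close>

definition dWhitney :: "nat \<Rightarrow> complex \<Rightarrow> nat \<Rightarrow> nat \<Rightarrow> complex" where
  "dWhitney m \<mu> n k =
     fact n * fps_nth (dexp \<mu> 1 * (fps_const (1 / fact k)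
       * (fps_const (1 / of_nat m) * (dexp \<mu> (of_nat m) - 1)) ^ k)) n"

definition dDowling :: "nat \<Rightarrow> complex \<Rightarrow> nat \<Rightarrow> complex poly" where
  "dDowling m \<mu> n = (\<Sum>k\<le>n. smult (dWhitney m \<mu> n k) (dfact_poly \<mu> k))"

lemma dWhitney_eq_0:
  assumes "n < k"
  shows "dWhitney m \<mu> n k = 0"
proof -
  define g where "g = fps_const (1 / of_nat m) * (dexp \<mu> (of_nat m) - 1)"
  have "fps_nth g 0 = 0"
    by (simp add: g_def dexp_def dfact_def)
  then have *: "fps_nth (g ^ k) i = 0" if "i < k" for i
    using that startsby_zero_power_prefix by blast
  have "fps_nth (dexp \<mu> 1 * (fps_const (1 / fact k) * g ^ k)) n = 0"
    unfolding fps_mult_nth[of "dexp \<mu> 1"] using assms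
    by (intro sum.neutral ballI) (auto simp: *)
  then show ?thesis
    by (simp add: dWhitney_def g_def)
qed

lemma dfact_poly_Suc: "dfact_poly \<mu> (Suc n) = dfact_poly \<mu> n * [:- of_nat n * \<mu>, 1:]"
  by (simp add: dfact_def of_nat_poly mult.commute)

lemma monic_dfact_poly: "degree (dfact_poly \<mu> n) = n \<and> lead_coeff (dfact_poly \<mu> n) = 1"
proof (induction n)
  case 0
  then show ?case by (simp add: dfact_def)
next
  case (Suc n)
  then have "dfact_poly \<mu> n \<noteq> 0" by force
  then have "degree (dfact_poly \<mu> (Suc n)) = Suc n"
    unfolding dfact_poly_Suc using Suc by (subst degree_mult_eq) auto
  moreover have "lead_coeff (dfact_poly \<mu> (Suc n)) = 1"
    unfolding dfact_poly_Suc lead_coeff_mult using conjunct2[OF Suc] by (metis degree_pCons_eq_if lead_coeff_pCons(1) lead_coeff_1 mult_1 one_neq_zero pCons_one)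
  ultimately show ?case by blast
qed

lemma degree_dfact_poly [simp]: "degree (dfact_poly \<mu> n) = n"
  using monic_dfact_poly by blast

lemma coeff_dfact_poly_self [simp]: "coeff (dfact_poly \<mu> n) n = 1"
proof -
  have "coeff (dfact_poly \<mu> n) (degree (dfact_poly \<mu> n)) = 1"
    using monic_dfact_poly by blast
  then show ?thesis
    by (simp only: degree_dfact_poly)
qed

lemma vector_space_smult: "vector_space (smult :: complex \<Rightarrow> complex poly \<Rightarrow> complex poly)"
  by unfold_locales (simp_all add: smult_add_left smult_add_right)

lemma vector_space_times: "vector_space ((*) :: complex \<Rightarrow> complex \<Rightarrow> complex)"
  by unfold_locales (simp_all add: algebra_simps)

lemma span_dfact_poly: "module.span smult (range (dfact_poly \<mu>)) = UNIV"
proof -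
  interpret P: vector_space "smult :: complex \<Rightarrow> complex poly \<Rightarrow> complex poly"
    by (rule vector_space_smult)
  have "p \<in> P.span (range (dfact_poly \<mu>))" if "degree p < n" for p n
    using that
  proof (induction n arbitrary: p)
    case 0
    then show ?case by simp
  next
    case (Suc n)
    define q where "q = p - smult (coeff p n) (dfact_poly \<mu> n)"
    have s: "smult (coeff p n) (dfact_poly \<mu> n) \<in> P.span (range (dfact_poly \<mu>))"
      by (intro P.span_scale P.span_base) simp
    have "degree q \<le> n"
      unfolding q_def using Suc.prems
      by (intro degree_diff_le order.trans[OF degree_smult_le]) auto
    moreover have "coeff q n = 0"
      by (simp add: q_def)
    ultimately have "q = 0 \<or> degree q < n"
      by (metis le_neq_implies_less leading_coeff_0_iff)
    then have "q \<in> P.span (range (dfact_poly \<mu>))"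
      using Suc.IH P.span_zero by blast
    then show ?case
      using P.span_add[OF _ s, of q] by (simp add: q_def)
  qed
  then show ?thesis by blast
qed

lemma independent_dfact_poly: "\<not> module.dependent smult (range (dfact_poly \<mu>))"
proof -
  interpret P: vector_space "smult :: complex \<Rightarrow> complex poly \<Rightarrow> complex poly"
    by (rule vector_space_smult)
  show ?thesis
    unfolding P.independent_explicit_finite_subsets
  proof (intro allI impI, rule ccontr)
    fix S :: "complex poly set" and u
    assume S: "S \<subseteq> range (dfact_poly \<mu>)" "finite S"
      and 0: "(\<Sum>v\<in>S. smult (u v) v) = 0" and nz: "\<not> (\<forall>v\<in>S. u v = 0)"
    define T where "T = {v\<in>S. u v \<noteq> 0}"
    have T: "finite T" "T \<noteq> {}"
      using S nz by (auto simp: T_def)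
    define w where "w = arg_max_on degree T"
    have w: "w \<in> T" and max: "degree v \<le> degree w" if "v \<in> T" for v
    proof -
      have "Max (degree ` T) \<in> degree ` T" using T by simp
      then obtain v0 where "v0 \<in> T" "degree v0 = Max (degree ` T)" by auto
      then have "is_arg_max degree (\<lambda>x. x \<in> T) v0"
        using T by (auto simp: is_arg_max_linorder)
      then have "is_arg_max degree (\<lambda>x. x \<in> T) w"
        unfolding w_def arg_max_on_def arg_max_def by (rule someI)
      then show "w \<in> T" "degree v \<le> degree w"
        using that by (auto simp: is_arg_max_linorder)
    qed
    have wT: "w \<in> T" using w T by blast
    obtain j where j: "w = dfact_poly \<mu> j" using wT S by (auto simp: T_def)
    have z: "u v * coeff v j = 0" if v: "v \<in> S - {w}" for v
    proof (cases "v \<in> T")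
      case True
      obtain i where i: "v = dfact_poly \<mu> i" using v S by blast
      have "i < j" using max[OF True] v i j by (cases "i = j") auto
      then show ?thesis using i by (simp add: coeff_eq_0)
    qed (use v in \<open>auto simp: T_def\<close>)
    have "0 = coeff (\<Sum>v\<in>S. smult (u v) v) j" by (simp add: 0)
    also have "\<dots> = (\<Sum>v\<in>S. u v * coeff v j)" by (simp add: coeff_sum)
    also have "\<dots> = u w * coeff w j"
      using wT S sum.neutral[of "S - {w}", OF ballI[OF z]]
      by (subst sum.remove[of _ w]) (simp_all add: T_def)
    finally show False using wT j by (simp add: T_def)
  qed
qed

theorem dumbral_functional_ex1: "\<exists>!L. dumbral_functional \<mu> f L"
proof -
  interpret PC: vector_space_pair
    "smult :: complex \<Rightarrow> complex poly \<Rightarrow> complex poly" "(*) :: complex \<Rightarrow> complex \<Rightarrow> complex"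
    using vector_space_smult vector_space_times by (simp add: vector_space_pair_def)
  obtain L where L: "Vector_Spaces.linear smult (*) L"
    and Lv: "\<forall>v\<in>range (dfact_poly \<mu>). L v = fact (degree v) * fps_nth f (degree v)"
    using PC.linear_independent_extend[OF independent_dfact_poly[of \<mu>],
        of "\<lambda>v. fact (degree v) * fps_nth f (degree v)"] by blast
  show ?thesis
  proof (rule ex1I[of _ L])
    show "dumbral_functional \<mu> f L"
      using L Lv by (simp add: dumbral_functional_def)
  next
    fix M assume "dumbral_functional \<mu> f M"
    then have M: "Vector_Spaces.linear smult (*) M"
      and Mv: "\<And>k. M (dfact_poly \<mu> k) = fact k * fps_nth f k"
      by (auto simp: dumbral_functional_def)
    show "M = L"
    proof
      fix p
      show "M p = L p"
        by (rule PC.linear_eq_on[OF M L, of p "range (dfact_poly \<mu>)"])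
          (use Lv Mv span_dfact_poly[of \<mu>] in auto)
    qed
  qed
qed

corollary dumbral_functional_dumbral: "dumbral_functional \<mu> f (dumbral \<mu> f)"
  unfolding dumbral_def by (rule theI'[OF dumbral_functional_ex1])

end

theory Submission
  imports Defs
begin

text \<open>Let \<open>g = (e\<^sub>\<lambda>\<^sup>m(t) - 1)/m\<close>, \<open>h = log\<^sub>\<lambda>\<^sub>/\<^sub>m(1 + mt)/m\<close> and \<open>H = (1 + mt)\<^sup>-\<^sup>1\<^sup>/\<^sup>m\<close>.
  Since \<open>e\<^sub>\<lambda>\<^sup>x(h(t)) = (1 + mt)\<^sup>x\<^sup>/\<^sup>m\<close>, the series \<open>h\<close> is the compositional inverse of \<open>g\<close>
  and \<open>H\<close> is the reciprocal of \<open>e\<^sub>\<lambda> \<circ> h\<close>. Hence \<open>H \<cdot> ((e\<^sub>\<lambda> g\<^sup>j) \<circ> h) = t\<^sup>j\<close>, which says that the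
  Whitney matrix is inverted by the coefficients \<open>i!/k! [t\<^sup>i] H h\<^sup>k\<close>. This is the claim
  for \<open>p = (x)\<^sub>i\<^sub>,\<^sub>\<lambda>\<close>, and both sides are linear in \<open>p\<close>.\<close>

lemma smult_sum_right: "smult c (\<Sum>i\<in>A. f i) = (\<Sum>i\<in>A. smult c (f i))"
  by (induction A rule: infinite_finite_induct) (simp_all add: smult_add_right)

text \<open>Both sides solve \<open>(1 + t) F' = a b F\<close> with \<open>F(0) = 1\<close>, and
  that solution is unique.\<close>

lemma fps_binomial_compose_binomial:
  fixes a b :: "'a::field_char_0"
  shows "fps_binomial a oo (fps_binomial b - 1) = fps_binomial (a * b)"
proof -
  let ?u = "fps_binomial b - 1 :: 'a fps" and ?x1 = "1 + fps_X :: 'a fps"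
  define F where "F = fps_binomial a oo ?u"
  have u0: "?u $ 0 = 0" by simp
  have inv: "inverse ?x1 oo ?u = inverse (fps_binomial b)"
    by (subst fps_inverse_compose) (simp_all add: fps_compose_add_distrib)
  have "fps_deriv F = ((fps_const a * fps_binomial a * inverse ?x1) oo ?u)
      * (fps_const b * fps_binomial b * inverse ?x1)"
    unfolding F_def fps_compose_deriv[OF u0]
    by (simp add: fps_binomial_deriv fps_divide_unit)
  \<comment> \<open>Since \<open>1 + ?u = (1 + t)^b\<close>, the composed reciprocal cancels the
    power \<open>(1 + t)^b\<close> coming from the derivative of \<open>?u\<close>.\<close>
  also have "\<dots> = fps_const (a * b) * F * inverse ?x1
      * (fps_binomial b * inverse (fps_binomial b))"
    by (simp add: fps_compose_mult_distrib[OF u0] inv flip: F_def fps_const_mult)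
  also have "fps_binomial b * inverse (fps_binomial b) = 1"
    by (simp add: inverse_mult_eq_1')
  finally have "fps_deriv F = fps_const (a * b) * F / ?x1"
    by (simp add: fps_divide_unit)
  moreover have "F $ 0 = 1" by (simp add: F_def)
  ultimately show ?thesis
    using fps_binomial_ODE_unique' unfolding F_def by blast
qed

text \<open>Taking \<open>\<mu>\<close> out of each of the \<open>k\<close> factors leaves
  \<open>k!\<close> times a generalized binomial coefficient in \<open>x / \<mu>\<close>.\<close>

lemma dexp_eq_binomial:
  assumes "\<mu> \<noteq> 0"
  shows "dexp \<mu> x = fps_dilate \<mu> (fps_binomial (x / \<mu>))"
proof (rule fps_ext)
  fix k
  have "dfact \<mu> x k = (\<Prod>i<k. \<mu> * (x / \<mu> - of_nat i))"
    unfolding dfact_def using assms by (intro prod.cong) (auto simp: field_simps)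
  also have "\<dots> = \<mu> ^ k * (\<Prod>i<k. x / \<mu> - of_nat i)"
    by (simp add: prod.distrib)
  finally show "dexp \<mu> x $ k = fps_dilate \<mu> (fps_binomial (x / \<mu>)) $ k"
    by (simp add: dexp_def gbinomial_prod_rev atLeast0LessThan)
qed

text \<open>For nonzero \<open>\<mu>\<close> and \<open>c\<close>, the compositional inverse of
  \<open>(dexp \<mu> c - 1) / c\<close>; the theorem takes \<open>c = m\<close>.\<close>

definition dowling_log :: "complex \<Rightarrow> complex \<Rightarrow> complex fps" where
  "dowling_log \<mu> c = fps_const (1 / c) * fps_dilate c (dlog1p (\<mu> / c))"

lemma dowling_log_nth_0 [simp]: "dowling_log \<mu> c $ 0 = 0"
  by (simp add: dowling_log_def dlog1p_def)

text \<open>For \<open>h = dowling_log \<mu> c\<close> one has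
  \<open>1 + \<mu> h = (1 + c t)^(\<mu> / c)\<close>; raising this to the power
  \<open>x / \<mu>\<close> multiplies the exponents.\<close>

lemma dexp_compose_dowling_log:
  assumes "\<mu> \<noteq> 0" "c \<noteq> 0"
  shows "dexp \<mu> x oo dowling_log \<mu> c = fps_dilate c (fps_binomial (x / c))"
proof -
  have "(fps_const \<mu> * fps_X) oo dowling_log \<mu> c = fps_const \<mu> * dowling_log \<mu> c"
    by (simp add: fps_compose_mult_distrib fps_X_fps_compose_startby0)
  also have "\<dots> = fps_dilate c (fps_binomial (\<mu> / c) - 1)"
    using assms
    by (simp add: dowling_log_def dlog1p_def fps_compose_mult_distrib flip: mult.assoc)
  finally have *: "(fps_const \<mu> * fps_X) oo dowling_log \<mu> c
      = fps_dilate c (fps_binomial (\<mu> / c) - 1)" .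
  have "dexp \<mu> x oo dowling_log \<mu> c
      = fps_binomial (x / \<mu>) oo ((fps_const \<mu> * fps_X) oo dowling_log \<mu> c)"
    unfolding dexp_eq_binomial[OF assms(1)] by (subst fps_compose_assoc) simp_all
  also have "\<dots> = (fps_binomial (x / \<mu>) oo (fps_binomial (\<mu> / c) - 1)) oo (fps_const c * fps_X)"
    unfolding * by (subst fps_compose_assoc) simp_all
  also have "\<dots> = fps_dilate c (fps_binomial (x / c))"
    unfolding fps_binomial_compose_binomial using assms by simp
  finally show ?thesis .
qed

text \<open>In \<open>dexp_compose_dowling_log\<close>, \<open>x = c\<close> turns the base of the
  \<open>j\<close>-th power into \<open>t\<close>, and \<open>x = 1\<close> gives
  \<open>(1 + c t)^(1 / c)\<close>, which the prefactor cancels.\<close>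

lemma whitney_series_compose:
  assumes "\<mu> \<noteq> 0" "c \<noteq> 0"
  shows "fps_dilate c (fps_binomial (- 1 / c)) *
    ((dexp \<mu> 1 * (fps_const (1 / c) * (dexp \<mu> c - 1)) ^ j) oo dowling_log \<mu> c) = fps_X ^ j"
proof -
  have "(fps_const (1 / c) * (dexp \<mu> c - 1)) oo dowling_log \<mu> c
      = fps_const (1 / c) * (fps_dilate c (1 + fps_X) - 1)"
    using assms dexp_compose_dowling_log[OF assms, of c]
    by (simp add: fps_compose_mult_distrib fps_compose_sub_distrib fps_binomial_1)
  also have "\<dots> = fps_X"
    using assms by (simp add: fps_compose_add_distrib flip: mult.assoc)
  finally have g: "(fps_const (1 / c) * (dexp \<mu> c - 1)) oo dowling_log \<mu> c = fps_X" .
  have "fps_dilate c (fps_binomial (- 1 / c)) * fps_dilate c (fps_binomial (1 / c))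
      = fps_dilate c (fps_binomial (- 1 / c + 1 / c))"
    unfolding fps_binomial_add_mult by (rule fps_compose_mult_distrib[symmetric]) simp
  then have "fps_dilate c (fps_binomial (- 1 / c)) * fps_dilate c (fps_binomial (1 / c)) = 1"
    by simp
  then show ?thesis
    by (simp add: fps_compose_mult_distrib dexp_compose_dowling_log[OF assms] g
        flip: fps_compose_power mult.assoc)
qed

text \<open>As \<open>h ^ k\<close> starts at degree \<open>k\<close> or later, terms with
  \<open>k > i\<close> vanish. The cutoff \<open>n\<close> is kept free of \<open>i\<close> so that
  sums for different \<open>i\<close> share one range.\<close>

lemma fps_mult_compose_nth:
  assumes "h $ 0 = (0 :: 'a::comm_ring_1)" "i \<le> n"
  shows "(H * (F oo h)) $ i = (\<Sum>k\<le>n. F $ k * (H * h ^ k) $ i)"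
proof -
  have "(F oo h) $ s = (\<Sum>k\<le>n. F $ k * h ^ k $ s)" if "s \<le> n" for s
    unfolding fps_compose_nth using that startsby_zero_power_prefix[OF assms(1)]
    by (intro sum.mono_neutral_left) auto
  then have "(H * (F oo h)) $ i = (\<Sum>s=0..i. \<Sum>k\<le>n. F $ k * (H $ s * h ^ k $ (i - s)))"
    unfolding fps_mult_nth using assms(2)
    by (simp add: sum_distrib_left mult.left_commute)
  also have "\<dots> = (\<Sum>k\<le>n. F $ k * (H * h ^ k) $ i)"
    by (subst sum.swap) (simp add: fps_mult_nth sum_distrib_left)
  finally show ?thesis .
qed

text \<open>This is coefficient \<open>i\<close> of \<open>whitney_series_compose\<close>, rescaled
  by factorials.\<close>

lemma dWhitney_inverse:
  assumes "\<mu> \<noteq> 0" "m > 0" "i \<le> n"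
  shows "(\<Sum>k\<le>n. fact i / fact k *
      (fps_dilate (of_nat m) (fps_binomial (- 1 / of_nat m)) * dowling_log \<mu> (of_nat m) ^ k) $ i
      * dWhitney m \<mu> k j) = (if i = j then 1 else 0)"
proof -
  define H where "H = fps_dilate (of_nat m) (fps_binomial (- 1 / of_nat m))"
  define F where
    "F = dexp \<mu> 1 * (fps_const (1 / of_nat m) * (dexp \<mu> (of_nat m) - 1)) ^ j"
  have W: "dWhitney m \<mu> k j = fact k / fact j * F $ k" for k
    unfolding dWhitney_def F_def mult.left_commute[of "dexp \<mu> 1"] fps_mult_left_const_nth
    by simp
  have "(\<Sum>k\<le>n. fact i / fact k * (H * dowling_log \<mu> (of_nat m) ^ k) $ i * dWhitney m \<mu> k j)
      = fact i / fact j * (\<Sum>k\<le>n. F $ k * (H * dowling_log \<mu> (of_nat m) ^ k) $ i)"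
    unfolding W sum_distrib_left by (intro sum.cong) simp_all
  also have "\<dots> = fact i / fact j * (fps_X ^ j :: complex fps) $ i"
    unfolding H_def F_def using assms
    by (subst fps_mult_compose_nth[symmetric], simp, simp, subst whitney_series_compose) simp_all
  \<comment> \<open>Only \<open>i = j\<close> gives a nonzero coefficient, and there
    \<open>fact i / fact j = 1\<close>.\<close>
  finally show ?thesis by (simp add: H_def)
qed

lemma dfact_poly_eq_sum_dDowling:
  assumes "\<mu> \<noteq> 0" "m > 0" "i \<le> n"
  shows "dfact_poly \<mu> i = (\<Sum>k\<le>n. smult (fact i / fact k *
      (fps_dilate (of_nat m) (fps_binomial (- 1 / of_nat m)) * dowling_log \<mu> (of_nat m) ^ k) $ i)
      (dDowling m \<mu> k))" (is "_ = (\<Sum>k\<le>n. smult (?c k) _)")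
proof -
  \<comment> \<open>The Whitney matrix is triangular, so its rows can be padded with zeros up to
    \<open>n\<close>; the two sums can then be swapped.\<close>
  have D: "dDowling m \<mu> k = (\<Sum>j\<le>n. smult (dWhitney m \<mu> k j) (dfact_poly \<mu> j))"
    if "k \<le> n" for k
    unfolding dDowling_def using that dWhitney_eq_0
    by (intro sum.mono_neutral_left) auto
  have "(\<Sum>k\<le>n. smult (?c k) (dDowling m \<mu> k))
      = (\<Sum>k\<le>n. \<Sum>j\<le>n. smult (?c k * dWhitney m \<mu> k j) (dfact_poly \<mu> j))"
    by (intro sum.cong) (simp_all add: D smult_sum_right)
  also have "\<dots> = (\<Sum>j\<le>n. smult (\<Sum>k\<le>n. ?c k * dWhitney m \<mu> k j) (dfact_poly \<mu> j))"
    by (subst sum.swap) (simp only: smult_sum)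
  also have "\<dots> = (\<Sum>j\<le>n. if i = j then dfact_poly \<mu> j else 0)"
    unfolding dWhitney_inverse[OF assms] by (intro sum.cong) simp_all
  also have "\<dots> = dfact_poly \<mu> i"
    using assms(3) by simp
  finally show ?thesis by simp
qed

text \<open>Each \<open>dfact_poly \<mu> n\<close> is monic of degree \<open>n\<close>, so leading
  terms can be removed one by one. Spanning alone would not bound the indices by
  \<open>n\<close>.\<close>

lemma poly_eq_sum_dfact_poly:
  assumes "degree p \<le> n"
  shows "\<exists>a. p = (\<Sum>i\<le>n. smult (a i) (dfact_poly \<mu> i))"
  using assms
proof (induction n arbitrary: p)
  case 0
  then obtain c where "p = [:c:]" by (metis le_zero_eq degree_eq_zeroE)
  then show ?case by (intro exI[of _ "\<lambda>_. c"]) (simp add: dfact_def)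
next
  case (Suc n)
  define q where "q = p - smult (coeff p (Suc n)) (dfact_poly \<mu> (Suc n))"
  have "degree q \<le> n"
  proof (rule degree_le, intro allI impI)
    fix k assume "n < k"
    then show "coeff q k = 0"
      using Suc.prems by (cases "k = Suc n") (auto simp: q_def coeff_eq_0)
  qed
  then obtain a where a: "q = (\<Sum>i\<le>n. smult (a i) (dfact_poly \<mu> i))"
    using Suc.IH by blast
  have "(\<Sum>i\<le>n. smult ((a(Suc n := coeff p (Suc n))) i) (dfact_poly \<mu> i)) = q"
    unfolding a by (intro sum.cong) auto
  then have "p = (\<Sum>i\<le>Suc n. smult ((a(Suc n := coeff p (Suc n))) i) (dfact_poly \<mu> i))"
    by (simp add: q_def)
  then show ?case by blast
qed

theorem theorem9:
  fixes lam :: real and m n :: nat and p :: "complex poly"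
  assumes "lam \<noteq> 0" and "m > 0" and "degree p \<le> n"
  defines "l \<equiv> complex_of_real lam"
  defines "C \<equiv> (\<lambda>k. 1 / fact k *
      dumbral l
        (fps_dilate (of_nat m) (fps_binomial (- 1 / of_nat m))
          * (fps_const (1 / of_nat m) * fps_dilate (of_nat m) (dlog1p (l / of_nat m))) ^ k)
        p)"
  shows "p = (\<Sum>k\<le>n. smult (C k) (dDowling m l k))"
proof -
  define f where "f k = fps_dilate (of_nat m) (fps_binomial (- 1 / of_nat m))
    * dowling_log l (of_nat m) ^ k" for k
  have l: "l \<noteq> 0" using assms(1) by (simp add: l_def)
  obtain a where a: "p = (\<Sum>i\<le>n. smult (a i) (dfact_poly l i))"
    using poly_eq_sum_dfact_poly[OF assms(3)] by blast
  \<comment> \<open>Linearity reduces the functional to its defining values on the falling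
    factorials.\<close>
  have C: "C k = (\<Sum>i\<le>n. a i * (fact i / fact k * f k $ i))" for k
  proof -
    have lin: "Vector_Spaces.linear smult (*) (dumbral l (f k))"
      and val: "\<And>i. dumbral l (f k) (dfact_poly l i) = fact i * f k $ i"
      using dumbral_functional_dumbral[of l "f k"] by (auto simp: dumbral_functional_def)
    interpret L: Vector_Spaces.linear smult "(*)" "dumbral l (f k)" by (rule lin)
    have "C k = 1 / fact k * dumbral l (f k) p"
      by (simp add: C_def f_def dowling_log_def)
    also have "\<dots> = 1 / fact k * (\<Sum>i\<le>n. a i * (fact i * f k $ i))"
      by (simp add: a L.sum L.scale val)
    finally show ?thesis by (simp add: sum_distrib_left mult.left_commute)
  qed
  \<comment> \<open>Each falling factorial is replaced by its Dowling expansion; collecting the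
    terms for each \<open>k\<close> then yields \<open>C k\<close>.\<close>
  have "p = (\<Sum>i\<le>n. smult (a i) (\<Sum>k\<le>n. smult (fact i / fact k * f k $ i) (dDowling m l k)))"
    unfolding a f_def using dfact_poly_eq_sum_dDowling[OF l assms(2)]
    by (intro sum.cong) simp_all
  also have "\<dots> = (\<Sum>k\<le>n. \<Sum>i\<le>n. smult (a i * (fact i / fact k * f k $ i)) (dDowling m l k))"
    by (subst sum.swap) (simp add: smult_sum_right)
  also have "\<dots> = (\<Sum>k\<le>n. smult (C k) (dDowling m l k))"
    unfolding C by (simp only: smult_sum)
  finally show ?thesis .
qed

end
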